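(* If $D$ is a principal ideal domain, then $\begin{pmatrix} 0 & 1 \\ 0 & 0 \end{pmatrix}$ is the unique prime element (up to associates) of $R(D)$; that is, it is a prime element, and every prime element of $R(D)$ is associated to it.
   Context: For an integral domain $D$, $R(D) = \left\{\begin{pmatrix} a & b \\ 0 & a \end{pmatrix} : a,b \in D\right\}$, a commutative ring with identity under matrix addition and multiplication. In a commutative ring $R$ with identity, elements $a,b$ are associates if $aR=bR$, and a nonzero nonunit $x\in R$ is a prime element if $xR$ is a prime ideal. *)

theory Defs
  imports "HOL-Analysis.Finite_Cartesian_Product" "HOL-Algebra.Ring_Divisibility"
begin

text \<open>
  Square matrices over a ring given by a record. The library's matrix operations on
  \<^typ>\<open>'a ^ 'n ^ 'n\<close> use the type class operations of \<^typ>\<open>'a\<close>, whereas here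
  the entries are combined by the operations of \<open>D\<close>.
\<close>

definition matrix_ring :: "('a, 'm) ring_scheme \<Rightarrow> ('a ^ 'n ^ 'n) ring" where
  "matrix_ring D =
    \<lparr>carrier = {A. \<forall>i j. A $ i $ j \<in> carrier D},
     mult = (\<lambda>A B. \<chi> i j. \<Oplus>\<^bsub>D\<^esub>k\<in>UNIV. A $ i $ k \<otimes>\<^bsub>D\<^esub> B $ k $ j),
     one = (\<chi> i j. if i = j then \<one>\<^bsub>D\<^esub> else \<zero>\<^bsub>D\<^esub>),
     zero = (\<chi> i j. \<zero>\<^bsub>D\<^esub>),
     add = (\<lambda>A B. \<chi> i j. A $ i $ j \<oplus>\<^bsub>D\<^esub> B $ i $ j)\<rparr>"

text \<open>\<open>mat2 a b c d\<close> has rows \<open>(a, b)\<close> and \<open>(c, d)\<close>.\<close>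

definition mat2 :: "'a \<Rightarrow> 'a \<Rightarrow> 'a \<Rightarrow> 'a \<Rightarrow> 'a ^ 2 ^ 2" where
  "mat2 a b c d =
    (\<chi> i j. if i = 1 then (if j = 1 then a else b) else (if j = 1 then c else d))"

definition RD :: "('a, 'm) ring_scheme \<Rightarrow> ('a ^ 2 ^ 2) ring" where
  "RD D = (matrix_ring D)
    \<lparr>carrier := {mat2 a b \<zero>\<^bsub>D\<^esub> a | a b. a \<in> carrier D \<and> b \<in> carrier D}\<rparr>"

definition associates :: "('a, 'm) ring_scheme \<Rightarrow> 'a \<Rightarrow> 'a \<Rightarrow> bool" where
  "associates R a b \<longleftrightarrow>
    a \<in> carrier R \<and> b \<in> carrier R \<and> PIdl\<^bsub>R\<^esub> a = PIdl\<^bsub>R\<^esub> b"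

definition prime_element :: "('a, 'm) ring_scheme \<Rightarrow> 'a \<Rightarrow> bool" where
  "prime_element R x \<longleftrightarrow>
    x \<in> carrier R \<and> x \<noteq> \<zero>\<^bsub>R\<^esub> \<and> x \<notin> Units R \<and> primeideal (PIdl\<^bsub>R\<^esub> x) R"

end

theory Submission
  imports Defs "HOL-Analysis.Cartesian_Space"
begin

text \<open>
  Writing an element with diagonal entry \<open>a\<close> and corner entry \<open>b\<close> as \<open>a + b\<epsilon>\<close>, the
  ring \<^term>\<open>RD D\<close> is the ring of dual numbers \<open>D[\<epsilon>]\<close> with \<open>\<epsilon>\<^sup>2 = 0\<close>, and the matrix in
  question is \<open>\<epsilon>\<close>. The ideal generated by \<open>\<epsilon>\<close> consists of the elements with zero diagonal,
  that is, it is the kernel of the projection \<open>a + b\<epsilon> \<mapsto> a\<close> onto the domain \<open>D\<close>; hence it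
  is prime.

  Conversely, if \<open>p = a + b\<epsilon>\<close> generates a prime ideal, then that ideal contains the nilpotent
  element \<open>\<epsilon>\<close>, so \<open>\<epsilon> = (c + d\<epsilon>)(a + b\<epsilon>)\<close>, which means \<open>ca = 0\<close> and \<open>cb + da = 1\<close>.
  If \<open>a \<noteq> 0\<close>, then \<open>c = 0\<close> and \<open>a\<close> is a unit of \<open>D\<close>, which makes \<open>p\<close> a unit. So \<open>a = 0\<close>,
  and then \<open>p = b\<epsilon>\<close> also lies in the ideal generated by \<open>\<epsilon>\<close>. The two ideals coincide.
\<close>

lemma mat2_eq_iff:
  "mat2 a b c d = mat2 a' b' c' d' \<longleftrightarrow> a = a' \<and> b = b' \<and> c = c' \<and> d = d'"
proof
  assume eq: "mat2 a b c d = mat2 a' b' c' d'"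
  have "mat2 a b c d $ i $ j = mat2 a' b' c' d' $ i $ j" for i j
    using eq by simp
  from this[of 1 1] this[of 1 2] this[of 2 1] this[of 2 2]
  show "a = a' \<and> b = b' \<and> c = c' \<and> d = d'"
    by (simp add: mat2_def)
qed auto

context cring
begin

lemma finsum_UNIV_2:
  fixes f :: "2 \<Rightarrow> 'a"
  assumes "f 1 \<in> carrier R" "f 2 \<in> carrier R"
  shows "(\<Oplus>k\<in>UNIV. f k) = f 1 \<oplus> f 2"
  using assms by (simp add: UNIV_2)

lemma RD_carrier:
  "carrier (RD R) = {mat2 a b \<zero> a | a b. a \<in> carrier R \<and> b \<in> carrier R}"
  by (simp add: RD_def)

lemma RD_carrierI:
  "a \<in> carrier R \<Longrightarrow> b \<in> carrier R \<Longrightarrow> mat2 a b \<zero> a \<in> carrier (RD R)"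
  by (auto simp: RD_carrier)

lemma RD_carrierE:
  assumes "x \<in> carrier (RD R)"
  obtains a b where "a \<in> carrier R" "b \<in> carrier R" "x = mat2 a b \<zero> a"
  using assms by (auto simp: RD_carrier)

lemma RD_zero: "\<zero>\<^bsub>RD R\<^esub> = mat2 \<zero> \<zero> \<zero> \<zero>"
  by (simp add: RD_def matrix_ring_def mat2_def)

lemma RD_one: "\<one>\<^bsub>RD R\<^esub> = mat2 \<one> \<zero> \<zero> \<one>"
  by (simp add: RD_def matrix_ring_def mat2_def vec_eq_iff forall_2)

lemma RD_add:
  assumes "a \<in> carrier R" "b \<in> carrier R" "c \<in> carrier R" "d \<in> carrier R"
  shows "mat2 a b \<zero> a \<oplus>\<^bsub>RD R\<^esub> mat2 c d \<zero> c = mat2 (a \<oplus> c) (b \<oplus> d) \<zero> (a \<oplus> c)"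
  using assms by (auto simp: RD_def matrix_ring_def mat2_def vec_eq_iff)

lemma RD_mult:
  assumes "a \<in> carrier R" "b \<in> carrier R" "c \<in> carrier R" "d \<in> carrier R"
  shows "mat2 a b \<zero> a \<otimes>\<^bsub>RD R\<^esub> mat2 c d \<zero> c
    = mat2 (a \<otimes> c) (a \<otimes> d \<oplus> b \<otimes> c) \<zero> (a \<otimes> c)"
  using assms by (auto simp: RD_def matrix_ring_def mat2_def vec_eq_iff finsum_UNIV_2)

lemmas RD_simps = RD_zero RD_one RD_add RD_mult

lemma cring_RD: "cring (RD R)"
proof (rule cringI)
  show "abelian_group (RD R)"
  proof (rule abelian_groupI)
    fix x assume "x \<in> carrier (RD R)"
    then obtain a b where ab: "a \<in> carrier R" "b \<in> carrier R" and x: "x = mat2 a b \<zero> a"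
      by (rule RD_carrierE)
    show "\<exists>y\<in>carrier (RD R). y \<oplus>\<^bsub>RD R\<^esub> x = \<zero>\<^bsub>RD R\<^esub>"
      using ab by (intro bexI[of _ "mat2 (\<ominus> a) (\<ominus> b) \<zero> (\<ominus> a)"])
        (auto simp: x RD_simps RD_carrierI l_neg)
  qed (auto elim!: RD_carrierE simp: RD_simps RD_carrierI a_ac mat2_eq_iff)
  show "comm_monoid (RD R)"
  proof (rule comm_monoidI)
    fix x y z
    assume "x \<in> carrier (RD R)" "y \<in> carrier (RD R)" "z \<in> carrier (RD R)"
    then show "x \<otimes>\<^bsub>RD R\<^esub> y \<otimes>\<^bsub>RD R\<^esub> z = x \<otimes>\<^bsub>RD R\<^esub> (y \<otimes>\<^bsub>RD R\<^esub> z)"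
      by (elim RD_carrierE) (simp add: RD_simps m_assoc a_assoc l_distr r_distr)
  qed (auto elim!: RD_carrierE simp: RD_simps RD_carrierI m_comm a_comm mat2_eq_iff)
  fix x y z
  assume "x \<in> carrier (RD R)" "y \<in> carrier (RD R)" "z \<in> carrier (RD R)"
  then show "(x \<oplus>\<^bsub>RD R\<^esub> y) \<otimes>\<^bsub>RD R\<^esub> z = x \<otimes>\<^bsub>RD R\<^esub> z \<oplus>\<^bsub>RD R\<^esub> y \<otimes>\<^bsub>RD R\<^esub> z"
    by (elim RD_carrierE) (simp add: RD_simps a_ac l_distr r_distr)
qed

text \<open>The inverse of \<open>a + b\<epsilon>\<close> is \<open>a\<^sup>-\<^sup>1 - b a\<^sup>-\<^sup>2 \<epsilon>\<close>.\<close>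

lemma RD_unitI:
  assumes a: "a \<in> Units R" and b: "b \<in> carrier R"
  shows "mat2 a b \<zero> a \<in> Units (RD R)"
proof -
  interpret RD: cring "RD R" by (rule cring_RD)
  have car: "a \<in> carrier R" "inv a \<in> carrier R"
    using a by auto
  define y where "y = mat2 (inv a) (\<ominus> (b \<otimes> inv a \<otimes> inv a)) \<zero> (inv a)"
  have "a \<otimes> \<ominus> (b \<otimes> inv a \<otimes> inv a) = \<ominus> (a \<otimes> inv a \<otimes> (b \<otimes> inv a))"
    using car b by (simp add: r_minus m_ac)
  then have "a \<otimes> \<ominus> (b \<otimes> inv a \<otimes> inv a) \<oplus> b \<otimes> inv a = \<zero>"
    using a car b by (simp add: Units_r_inv l_neg)
  then have "mat2 a b \<zero> a \<otimes>\<^bsub>RD R\<^esub> y = \<one>\<^bsub>RD R\<^esub>"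
    using a car b by (simp add: y_def RD_simps)
  moreover have "mat2 a b \<zero> a \<in> carrier (RD R)" "y \<in> carrier (RD R)"
    using car b by (simp_all add: y_def RD_carrierI)
  ultimately show ?thesis
    using RD.m_comm unfolding Units_def by auto
qed

text \<open>
  Since \<open>(a + b\<epsilon>)\<epsilon> = a\<epsilon>\<close>, multiplication by \<open>\<epsilon>\<close> moves the diagonal entry into the corner,
  and \<open>a\<close> is arbitrary.
\<close>

lemma PIdl_eps:
  "PIdl\<^bsub>RD R\<^esub> (mat2 \<zero> \<one> \<zero> \<zero>) = {mat2 \<zero> c \<zero> \<zero> | c. c \<in> carrier R}"
proof -
  have mult: "mat2 a b \<zero> a \<otimes>\<^bsub>RD R\<^esub> mat2 \<zero> \<one> \<zero> \<zero> = mat2 \<zero> a \<zero> \<zero>"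
    if "a \<in> carrier R" "b \<in> carrier R" for a b
    using that RD_mult[of a b \<zero> \<one>] by simp
  show ?thesis
  proof
    show "PIdl\<^bsub>RD R\<^esub> (mat2 \<zero> \<one> \<zero> \<zero>) \<subseteq> {mat2 \<zero> c \<zero> \<zero> | c. c \<in> carrier R}"
      using mult by (auto simp: cgenideal_def elim!: RD_carrierE)
    show "{mat2 \<zero> c \<zero> \<zero> | c. c \<in> carrier R} \<subseteq> PIdl\<^bsub>RD R\<^esub> (mat2 \<zero> \<one> \<zero> \<zero>)"
      using mult[OF _ zero_closed, symmetric] RD_carrierI[OF _ zero_closed]
      unfolding cgenideal_def by blast
  qed
qed

end

context "domain"
begin

text \<open>
  Diagonal entries multiply, so a product with zero diagonal has a factor with zero diagonal
  as soon as \<open>R\<close> has no zero divisors.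
\<close>

lemma prime_element_eps: "prime_element (RD R) (mat2 \<zero> \<one> \<zero> \<zero>)"
proof -
  interpret RD: cring "RD R" by (rule cring_RD)
  let ?e = "mat2 \<zero> \<one> \<zero> \<zero>"
  have e: "?e \<in> carrier (RD R)"
    by (simp add: RD_carrierI)
  have one: "\<one>\<^bsub>RD R\<^esub> \<notin> PIdl\<^bsub>RD R\<^esub> ?e"
    by (auto simp: PIdl_eps RD_one mat2_eq_iff)
  have "primeideal (PIdl\<^bsub>RD R\<^esub> ?e) (RD R)"
  proof (rule primeidealI)
    show "ideal (PIdl\<^bsub>RD R\<^esub> ?e) (RD R)"
      by (rule RD.cgenideal_ideal[OF e])
    show "cring (RD R)"
      by (rule cring_RD)
    show "carrier (RD R) \<noteq> PIdl\<^bsub>RD R\<^esub> ?e"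
      using one by auto
    fix x y
    assume "x \<in> carrier (RD R)" "y \<in> carrier (RD R)" and xy: "x \<otimes>\<^bsub>RD R\<^esub> y \<in> PIdl\<^bsub>RD R\<^esub> ?e"
    then obtain a b c d
      where car: "a \<in> carrier R" "b \<in> carrier R" "c \<in> carrier R" "d \<in> carrier R"
        and x: "x = mat2 a b \<zero> a" and y: "y = mat2 c d \<zero> c"
      by (elim RD_carrierE)
    have "a \<otimes> c = \<zero>"
      using xy car by (auto simp: x y RD_mult PIdl_eps mat2_eq_iff)
    then have "a = \<zero> \<or> c = \<zero>"
      using car by (simp add: integral_iff)
    then show "x \<in> PIdl\<^bsub>RD R\<^esub> ?e \<or> y \<in> PIdl\<^bsub>RD R\<^esub> ?e"
      using car by (auto simp: x y PIdl_eps)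
  qed
  moreover have "?e \<notin> Units (RD R)"
  proof
    assume "?e \<in> Units (RD R)"
    then obtain y where "y \<in> carrier (RD R)" "y \<otimes>\<^bsub>RD R\<^esub> ?e = \<one>\<^bsub>RD R\<^esub>"
      by (auto simp: Units_def)
    then show False
      using one by (auto simp: cgenideal_def)
  qed
  moreover have "?e \<noteq> \<zero>\<^bsub>RD R\<^esub>"
    by (simp add: RD_zero mat2_eq_iff)
  ultimately show ?thesis
    using e by (simp add: prime_element_def)
qed

text \<open>
  A prime ideal contains every nilpotent element, so \<open>p\<close> divides \<open>\<epsilon>\<close>. A unit on the diagonal
  of \<open>p\<close> is the only alternative to \<open>p\<close> being a multiple of \<open>\<epsilon>\<close>.
\<close>

lemma prime_element_associates_eps:
  assumes "prime_element (RD R) p"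
  shows "associates (RD R) p (mat2 \<zero> \<one> \<zero> \<zero>)"
proof -
  interpret RD: cring "RD R" by (rule cring_RD)
  let ?e = "mat2 \<zero> \<one> \<zero> \<zero>"
  have e: "?e \<in> carrier (RD R)"
    by (simp add: RD_carrierI)
  have p: "p \<in> carrier (RD R)" and nonunit: "p \<notin> Units (RD R)"
    and prime: "primeideal (PIdl\<^bsub>RD R\<^esub> p) (RD R)"
    using assms by (auto simp: prime_element_def)
  interpret P: primeideal "PIdl\<^bsub>RD R\<^esub> p" "RD R" by (rule prime)
  have "?e \<otimes>\<^bsub>RD R\<^esub> ?e = \<zero>\<^bsub>RD R\<^esub>"
    using RD_mult[of \<zero> \<one> \<zero> \<one>] by (simp add: RD_zero)
  then have e_in: "?e \<in> PIdl\<^bsub>RD R\<^esub> p"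
    using P.I_prime[OF e e] by auto
  obtain a b where ab: "a \<in> carrier R" "b \<in> carrier R" and p_eq: "p = mat2 a b \<zero> a"
    using p by (rule RD_carrierE)
  from e_in obtain x where "x \<in> carrier (RD R)" and x: "?e = x \<otimes>\<^bsub>RD R\<^esub> p"
    unfolding cgenideal_def by blast
  then obtain c d where cd: "c \<in> carrier R" "d \<in> carrier R" and x_eq: "x = mat2 c d \<zero> c"
    by (blast elim: RD_carrierE)
  have ca: "c \<otimes> a = \<zero>" and corner: "c \<otimes> b \<oplus> d \<otimes> a = \<one>"
    using x ab cd by (auto simp: x_eq p_eq RD_mult mat2_eq_iff)
  \<comment> \<open>With \<open>a \<noteq> 0\<close>, the diagonal equation forces \<open>c = 0\<close>, so the corner equation inverts \<open>a\<close>.\<close>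
  have "a = \<zero>"
  proof (rule ccontr)
    assume "a \<noteq> \<zero>"
    then have "c = \<zero>"
      using ca ab cd by (simp add: integral_iff)
    then have "d \<otimes> a = \<one>"
      using corner ab cd by simp
    then have "a \<in> Units R"
      using ab cd m_comm[of a d] unfolding Units_def by auto
    then show False
      using nonunit ab RD_unitI p_eq by blast
  qed
  then have "p \<in> PIdl\<^bsub>RD R\<^esub> ?e"
    using ab by (auto simp: p_eq PIdl_eps)
  then have "PIdl\<^bsub>RD R\<^esub> p = PIdl\<^bsub>RD R\<^esub> ?e"
    using e_in e p RD.cgenideal_minimal RD.cgenideal_ideal by (simp add: subset_antisym)
  then show ?thesis
    using e p by (simp add: associates_def)
qed

end

theorem corollary7:
  fixes D :: "('a, 'm) ring_scheme"
  assumes "principal_domain D"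
  shows "prime_element (RD D) (mat2 \<zero>\<^bsub>D\<^esub> \<one>\<^bsub>D\<^esub> \<zero>\<^bsub>D\<^esub> \<zero>\<^bsub>D\<^esub>) \<and>
    (\<forall>P. prime_element (RD D) P \<longrightarrow>
      associates (RD D) P (mat2 \<zero>\<^bsub>D\<^esub> \<one>\<^bsub>D\<^esub> \<zero>\<^bsub>D\<^esub> \<zero>\<^bsub>D\<^esub>))"
proof -
  interpret principal_domain D by (rule assms)
  show ?thesis
    using prime_element_eps prime_element_associates_eps by blast
qed

end
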